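(* Let $p,q\ge 0$ be integers with $n=p+q$, let $\mu\in C\ell_{p,q}$ satisfy $\mu^2=-1$, and let $\ell\ge 1$ be an integer. Let $X$ be a real random variable with Clifford algebra probability density function $f_X:\mathbb{R}\to C\ell_{p,q}$, and let $\phi_X(t)=\int_{\mathbb{R}} f_X(x)e^{\mu t x}\,dx$ be its Clifford algebra characteristic function. Then the $\ell$-th derivative of $\phi_X$ exists and is given by $$\frac{d^\ell}{dt^\ell}\phi_X(t)=\left(\int_{\mathbb{R}} x^\ell f_X(x)e^{\mu t x}\,dx\right)\mu^\ell .$$ Moreover, the $\ell$-th moment $m_\ell=E[X^\ell]$ satisfies $$m_\ell=E[X^\ell]=\left(\frac{d^\ell}{dt^\ell}\phi_X\right)(0)\,(-\mu)^\ell .$$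
   Context: $C\ell_{p,q}$ is the real associative Clifford algebra generated by $e_1,\dots,e_n$ ($n=p+q$) subject to $e_j e_k+e_k e_j=2\delta_{j,k}\varepsilon_j$, where $\varepsilon_j=1$ for $1\le j\le p$ and $\varepsilon_j=-1$ for $p+1\le j\le n$. It has real dimension $2^n$ with basis $e_\Sigma=e_{\sigma_1}\cdots e_{\sigma_r}$, for $\Sigma=\{\sigma_1<\dots<\sigma_r\}\subseteq\{1,\dots,n\}$, and $e_\emptyset=1$. Integrals and derivatives of $C\ell_{p,q}$-valued functions are taken coefficientwise. For $\mu\in C\ell_{p,q}$ with $\mu^2=-1$ and $\theta\in\mathbb{R}$, $e^{\mu\theta}=\cos\theta+\mu\sin\theta$. A Clifford algebra probability density function of a real random variable $X$ is a function $f_X=\sum_{\Sigma\subseteq\{1,\dots,n\}} e_\Sigma (f_X)_\Sigma:\mathbb{R}\to C\ell_{p,q}$ such that each real-valued coefficient function $(f_X)_\Sigma$ is a real probability density function, i.e. nonnegative with $\int_{\mathbb{R}}(f_X)_\Sigma(x)\,dx=1$. The $\ell$-th moment of $X$ is, by definition, $m_\ell=E[X^\ell]=\int_{\mathbb{R}} x^\ell f_X(x)\,dx$.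
   Formalization: The formal theorem additionally assumes that the ℓ-th moment exists, i.e. x^ℓ f_X(x) is coefficientwise absolutely integrable; without this the claim fails, e.g. for Cauchy densities with ℓ=1. *)

theory Defs
  imports "HOL-Analysis.Analysis" "HOL-Algebra.Module"
begin

text \<open>
  The Clifford algebra with \<open>p\<close> generators squaring to \<open>1\<close> and \<open>q\<close> generators squaring to \<open>-1\<close>
  is built on coefficient families: an element is a function \<open>x\<close> that vanishes outside the
  subsets of \<open>{1..p+q}\<close>, standing for the sum of the \<open>x \<Sigma> * e\<^sub>\<Sigma>\<close>.
  The product is the bilinear extension of \<open>e\<^sub>S e\<^sub>T = \<plusminus> e\<^sub>U\<close>, \<open>U\<close> the symmetric difference of \<open>S\<close>
  and \<open>T\<close>: sorting the concatenated word costs \<open>-1\<close> for every pair \<open>s \<in> S\<close>, \<open>t \<in> T\<close> with \<open>t < s\<close>,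
  and every common index \<open>i\<close> then contributes the square of \<open>e\<^sub>i\<close>.
\<close>

definition cl_eps :: "nat \<Rightarrow> nat \<Rightarrow> real" where
  "cl_eps p i = (if i \<le> p then 1 else - 1)"

definition cl_sign :: "nat \<Rightarrow> nat set \<Rightarrow> nat set \<Rightarrow> real" where
  "cl_sign p S T = (- 1) ^ card {(s, t). s \<in> S \<and> t \<in> T \<and> t < s} * (\<Prod>i\<in>S \<inter> T. cl_eps p i)"

definition Cl :: "nat \<Rightarrow> nat \<Rightarrow> (real, nat set \<Rightarrow> real) module" where
  "Cl p q =
    \<lparr> carrier = {x. \<forall>S. \<not> S \<subseteq> {1..p+q} \<longrightarrow> x S = 0},
      monoid.mult = (\<lambda>x y U. \<Sum>(S, T) \<in> {(S, T). S \<subseteq> {1..p+q} \<and> T \<subseteq> {1..p+q} \<and> sym_diff S T = U}.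
                        cl_sign p S T * x S * y T),
      one = (\<lambda>S. if S = {} then 1 else 0),
      ring.zero = (\<lambda>S. 0),
      add = (\<lambda>x y S. x S + y S),
      module.smult = (\<lambda>a x S. a * x S) \<rparr>"

definition cl_basis :: "nat set \<Rightarrow> nat set \<Rightarrow> real" where
  "cl_basis S = (\<lambda>T. if T = S then 1 else 0)"

text \<open>
  That \<open>Cl p q\<close> is the algebra described by generators and relations is witnessed by \<open>ring_Cl\<close>,
  \<open>Cl_smult_mult\<close>, \<open>Cl_generator_relation\<close> and \<open>cl_basis_eq_prod\<close>.
\<close>

lemma Cl_carrier_iff: "x \<in> carrier (Cl p q) \<longleftrightarrow> (\<forall>S. \<not> S \<subseteq> {1..p+q} \<longrightarrow> x S = 0)"
  by (simp add: Cl_def)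

lemma Cl_simps:
  "\<one>\<^bsub>Cl p q\<^esub> = cl_basis {}"
  "\<zero>\<^bsub>Cl p q\<^esub> = (\<lambda>S. 0)"
  "x \<oplus>\<^bsub>Cl p q\<^esub> y = (\<lambda>S. x S + y S)"
  "a \<odot>\<^bsub>Cl p q\<^esub> x = (\<lambda>S. a * x S)"
  by (simp_all add: Cl_def cl_basis_def)

lemma cl_basis_carrier: "S \<subseteq> {1..p+q} \<Longrightarrow> cl_basis S \<in> carrier (Cl p q)"
  by (auto simp: Cl_carrier_iff cl_basis_def)

lemma sym_diff_eq_iff: "sym_diff S T = U \<longleftrightarrow> T = sym_diff S (U :: 'a set)"
  by blast

lemma Cl_mult:
  "(x \<otimes>\<^bsub>Cl p q\<^esub> y) U =
     (if U \<subseteq> {1..p+q}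
      then \<Sum>S\<in>Pow {1..p+q}. cl_sign p S (sym_diff S U) * x S * y (sym_diff S U) else 0)"
proof (cases "U \<subseteq> {1..p+q}")
  case True
  have "(x \<otimes>\<^bsub>Cl p q\<^esub> y) U =
     (\<Sum>(S, T) \<in> {(S, T). S \<subseteq> {1..p+q} \<and> T \<subseteq> {1..p+q} \<and> sym_diff S T = U}.
                        cl_sign p S T * x S * y T)"
    by (simp add: Cl_def)
  also have "\<dots> = (\<Sum>S\<in>Pow {1..p+q}. cl_sign p S (sym_diff S U) * x S * y (sym_diff S U))"
    by (rule sum.reindex_bij_witness[of _ "\<lambda>S. (S, sym_diff S U)" fst])
       (use True in \<open>auto simp: sym_diff_eq_iff\<close>)
  finally show ?thesis using True by simp
next
  case False
  then have "{(S, T). S \<subseteq> {1..p+q} \<and> T \<subseteq> {1..p+q} \<and> sym_diff S T = U} = {}"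
    by auto
  then show ?thesis using False by (simp only: Cl_def monoid.simps) simp
qed

lemma prod_sym_diff_unit:
  fixes h :: "'a \<Rightarrow> real"
  assumes "finite S" "finite T" "\<And>i. h i * h i = 1"
  shows "prod h (sym_diff S T) = prod h S * prod h T"
proof -
  have S: "prod h S = prod h (S - T) * prod h (S \<inter> T)"
    using assms(1) by (metis Diff_disjoint Int_Diff_Un Int_commute Int_Diff_disjoint finite_Diff finite_Int
        mult.commute prod.union_disjoint)
  have T: "prod h T = prod h (T - S) * prod h (S \<inter> T)"
    using assms(2) by (metis Int_Diff_Un Int_commute Int_Diff_disjoint finite_Diff finite_Int
        mult.commute prod.union_disjoint)
  have "prod h (S \<inter> T) * prod h (S \<inter> T) = 1"
    using assms(3) by (simp flip: prod.distrib)
  moreover have "prod h (sym_diff S T) = prod h (S - T) * prod h (T - S)"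
    using assms(1,2) by (intro prod.union_disjoint) auto
  moreover have "a * c * (b * c) = a * b" if "c * c = 1" for a b c :: real
  proof -
    have "a * c * (b * c) = a * b * (c * c)" by (simp only: mult_ac)
    then show ?thesis using that by simp
  qed
  ultimately show ?thesis unfolding S T by simp
qed

lemma cl_sign_prod:
  assumes "finite S" "finite T"
  shows "cl_sign p S T =
    (\<Prod>s\<in>S. \<Prod>t\<in>T. if t < s then - 1 else 1) * (\<Prod>i\<in>S \<inter> T. cl_eps p i)"
proof -
  have "(\<Prod>s\<in>S. \<Prod>t\<in>T. if t < s then - 1 else (1::real)) =
        (\<Prod>z\<in>S \<times> T. if snd z < fst z then - 1 else 1)"
    by (simp add: prod.cartesian_product case_prod_beta)
  also have "\<dots> = (\<Prod>z\<in>{z \<in> S \<times> T. snd z < fst z}. - 1)"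
    using assms by (intro prod.inter_filter[symmetric]) auto
  also have "\<dots> = (- 1) ^ card {(s, t). s \<in> S \<and> t \<in> T \<and> t < s}"
    by (simp add: case_prod_beta' mem_Times_iff conj_assoc)
  finally show ?thesis by (simp add: cl_sign_def)
qed

lemma cl_sign_cocycle:
  assumes [simp]: "finite S" "finite T" "finite U"
  shows "cl_sign p S T * cl_sign p (sym_diff S T) U = cl_sign p S (sym_diff T U) * cl_sign p T U"
proof -
  let ?h = "\<lambda>s t::nat. if t < s then - 1 else (1::real)"
  have h: "prod (?h s) A * prod (?h s) A = 1" for s A
    by (simp add: if_distrib flip: prod.distrib cong: if_cong)
  have l: "(\<Prod>s\<in>sym_diff S T. prod (?h s) U) = (\<Prod>s\<in>S. prod (?h s) U) * (\<Prod>s\<in>T. prod (?h s) U)"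
    by (rule prod_sym_diff_unit) (simp_all only: assms h)
  have r: "(\<Prod>s\<in>S. prod (?h s) (sym_diff T U)) = (\<Prod>s\<in>S. prod (?h s) T) * (\<Prod>s\<in>S. prod (?h s) U)"
    by (subst prod_sym_diff_unit) (simp_all add: prod.distrib)
  have e: "cl_eps p i * cl_eps p i = 1" for i by (simp add: cl_eps_def)
  have "sym_diff S T \<inter> U = sym_diff (S \<inter> U) (T \<inter> U)" "S \<inter> sym_diff T U = sym_diff (S \<inter> T) (S \<inter> U)"
    by auto
  then have el: "prod (cl_eps p) (sym_diff S T \<inter> U) = prod (cl_eps p) (S \<inter> U) * prod (cl_eps p) (T \<inter> U)"
    and er: "prod (cl_eps p) (S \<inter> sym_diff T U) = prod (cl_eps p) (S \<inter> T) * prod (cl_eps p) (S \<inter> U)"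
    by (simp_all only:) (rule prod_sym_diff_unit; simp add: e)+
  have fin: "finite (sym_diff S T)" "finite (sym_diff T U)" by simp_all
  show ?thesis
    unfolding cl_sign_prod[OF assms(1,2)] cl_sign_prod[OF assms(2,3)]
      cl_sign_prod[OF fin(1) assms(3)] cl_sign_prod[OF assms(1) fin(2)] l r el er
    by simp
qed

lemma cl_sign_empty [simp]: "cl_sign p {} T = 1" "cl_sign p S {} = 1"
  by (simp_all add: cl_sign_def)

lemma Cl_mult_assoc:
  "(x \<otimes>\<^bsub>Cl p q\<^esub> y) \<otimes>\<^bsub>Cl p q\<^esub> z = x \<otimes>\<^bsub>Cl p q\<^esub> (y \<otimes>\<^bsub>Cl p q\<^esub> z)"
proof
  fix V
  let ?N = "{1..p+q}"
  show "((x \<otimes>\<^bsub>Cl p q\<^esub> y) \<otimes>\<^bsub>Cl p q\<^esub> z) V = (x \<otimes>\<^bsub>Cl p q\<^esub> (y \<otimes>\<^bsub>Cl p q\<^esub> z)) V"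
  proof (cases "V \<subseteq> ?N")
    case V: True
    have "((x \<otimes>\<^bsub>Cl p q\<^esub> y) \<otimes>\<^bsub>Cl p q\<^esub> z) V =
      (\<Sum>U\<in>Pow ?N. \<Sum>S\<in>Pow ?N. cl_sign p S (sym_diff S U) * x S * y (sym_diff S U)
          * (cl_sign p U (sym_diff U V) * z (sym_diff U V)))"
      using V by (simp add: Cl_mult sum_distrib_left sum_distrib_right mult_ac)
    also have "\<dots> = (\<Sum>S\<in>Pow ?N. \<Sum>U\<in>Pow ?N. cl_sign p S (sym_diff S U) * x S * y (sym_diff S U)
          * (cl_sign p U (sym_diff U V) * z (sym_diff U V)))"
      by (rule sum.swap)
    also have "\<dots> = (\<Sum>S\<in>Pow ?N. \<Sum>T\<in>Pow ?N. cl_sign p S (sym_diff S V) * x S *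
          (cl_sign p T (sym_diff T (sym_diff S V)) * y T * z (sym_diff T (sym_diff S V))))"
    proof (rule sum.cong[OF refl])
      fix S assume S: "S \<in> Pow ?N"
      have "(\<Sum>U\<in>Pow ?N. cl_sign p S (sym_diff S U) * x S * y (sym_diff S U)
          * (cl_sign p U (sym_diff U V) * z (sym_diff U V))) =
        (\<Sum>T\<in>Pow ?N. cl_sign p S T * x S * y T
          * (cl_sign p (sym_diff S T) (sym_diff (sym_diff S T) V) * z (sym_diff (sym_diff S T) V)))"
      proof (rule sum.reindex_bij_witness[of _ "\<lambda>T. sym_diff S T" "\<lambda>T. sym_diff S T"])
        fix U
        have *: "sym_diff S (sym_diff S U) = U" by blast
        then show "sym_diff S (sym_diff S U) = U" "sym_diff S (sym_diff S U) = U" by blast+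
        show "cl_sign p S (sym_diff S U) * x S * y (sym_diff S U) *
          (cl_sign p (sym_diff S (sym_diff S U)) (sym_diff (sym_diff S (sym_diff S U)) V) *
           z (sym_diff (sym_diff S (sym_diff S U)) V)) =
          cl_sign p S (sym_diff S U) * x S * y (sym_diff S U) *
          (cl_sign p U (sym_diff U V) * z (sym_diff U V))"
          unfolding * ..
      qed (use S in auto)
      also have "\<dots> = (\<Sum>T\<in>Pow ?N. cl_sign p S (sym_diff S V) * x S *
          (cl_sign p T (sym_diff T (sym_diff S V)) * y T * z (sym_diff T (sym_diff S V))))"
      proof (rule sum.cong[OF refl])
        fix T assume T: "T \<in> Pow ?N"
        let ?W = "sym_diff T (sym_diff S V)"
        have fin: "finite S" "finite T" "finite V"
          using S T V by (auto intro: finite_subset)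
        then have "cl_sign p S T * cl_sign p (sym_diff S T) ?W
            = cl_sign p S (sym_diff T ?W) * cl_sign p T ?W"
          by (intro cl_sign_cocycle) auto
        moreover have "sym_diff T ?W = sym_diff S V" "sym_diff (sym_diff S T) V = ?W"
          by blast+
        moreover have perm: "a * b * c * (d * e) = a' * b * (d' * c * e)" if "a * d = a' * d'"
          for a b c d e a' d' :: real
        proof -
          have "a * b * c * (d * e) = a * d * (b * c * e)" by (simp only: mult_ac)
          also have "\<dots> = a' * b * (d' * c * e)" unfolding that by (simp only: mult_ac)
          finally show ?thesis .
        qed
        ultimately have "cl_sign p S T * cl_sign p (sym_diff S T) (sym_diff (sym_diff S T) V)
            = cl_sign p S (sym_diff S V) * cl_sign p T ?W"
          and "sym_diff (sym_diff S T) V = ?W"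
          by (simp_all only:)
        then show "cl_sign p S T * x S * y T
          * (cl_sign p (sym_diff S T) (sym_diff (sym_diff S T) V) * z (sym_diff (sym_diff S T) V))
          = cl_sign p S (sym_diff S V) * x S * (cl_sign p T ?W * y T * z ?W)"
          by (simp only: perm)
      qed
      finally show "(\<Sum>U\<in>Pow ?N. cl_sign p S (sym_diff S U) * x S * y (sym_diff S U)
          * (cl_sign p U (sym_diff U V) * z (sym_diff U V))) =
          (\<Sum>T\<in>Pow ?N. cl_sign p S (sym_diff S V) * x S *
          (cl_sign p T (sym_diff T (sym_diff S V)) * y T * z (sym_diff T (sym_diff S V))))" .
    qed
    also have "\<dots> = (x \<otimes>\<^bsub>Cl p q\<^esub> (y \<otimes>\<^bsub>Cl p q\<^esub> z)) V"
    proof -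
      have "(x \<otimes>\<^bsub>Cl p q\<^esub> (y \<otimes>\<^bsub>Cl p q\<^esub> z)) V =
        (\<Sum>S\<in>Pow ?N. cl_sign p S (sym_diff S V) * x S * (y \<otimes>\<^bsub>Cl p q\<^esub> z) (sym_diff S V))"
        using V by (subst Cl_mult) simp
      also have "\<dots> = (\<Sum>S\<in>Pow ?N. \<Sum>T\<in>Pow ?N. cl_sign p S (sym_diff S V) * x S *
          (cl_sign p T (sym_diff T (sym_diff S V)) * y T * z (sym_diff T (sym_diff S V))))"
      proof (rule sum.cong[OF refl])
        fix S assume "S \<in> Pow ?N"
        then have "sym_diff S V \<subseteq> ?N" using V by auto
        then show "cl_sign p S (sym_diff S V) * x S * (y \<otimes>\<^bsub>Cl p q\<^esub> z) (sym_diff S V) =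
          (\<Sum>T\<in>Pow ?N. cl_sign p S (sym_diff S V) * x S *
          (cl_sign p T (sym_diff T (sym_diff S V)) * y T * z (sym_diff T (sym_diff S V))))"
          by (simp only: Cl_mult if_True sum_distrib_left)
      qed
      finally show ?thesis ..
    qed
    finally show ?thesis .
  qed (simp add: Cl_mult)
qed

lemma cl_basis_mult:
  assumes "S \<subseteq> {1..p+q}" "T \<subseteq> {1..p+q}"
  shows "cl_basis S \<otimes>\<^bsub>Cl p q\<^esub> cl_basis T = cl_sign p S T \<odot>\<^bsub>Cl p q\<^esub> cl_basis (sym_diff S T)"
proof
  fix U
  have "(\<Sum>A\<in>Pow {1..p+q}. cl_sign p A (sym_diff A U) * cl_basis S A * cl_basis T (sym_diff A U)) =
     (\<Sum>A\<in>Pow {1..p+q}. if A = S then cl_sign p S (sym_diff S U) * cl_basis T (sym_diff S U) else 0)"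
    by (intro sum.cong) (auto simp: cl_basis_def)
  also have "\<dots> = cl_sign p S (sym_diff S U) * cl_basis T (sym_diff S U)"
    using assms by (subst sum.delta) auto
  also have "\<dots> = cl_sign p S T * cl_basis (sym_diff S T) U"
  proof (cases "U = sym_diff S T")
    case True
    then have "sym_diff S U = T" by blast
    then show ?thesis using True by (simp add: cl_basis_def)
  next
    case False
    then have "sym_diff S U \<noteq> T" by blast
    then show ?thesis using False by (simp only: cl_basis_def) simp
  qed
  moreover have "cl_basis (sym_diff S T) U = 0" if "\<not> U \<subseteq> {1..p+q}"
    using that assms by (auto simp: cl_basis_def)
  ultimately show "(cl_basis S \<otimes>\<^bsub>Cl p q\<^esub> cl_basis T) U = (cl_sign p S T \<odot>\<^bsub>Cl p q\<^esub> cl_basis (sym_diff S T)) U"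
    by (simp add: Cl_mult Cl_simps)
qed

lemma ring_Cl: "ring (Cl p q)"
proof (rule ringI)
  show "abelian_group (Cl p q)"
  proof (rule abelian_groupI)
    fix x assume "x \<in> carrier (Cl p q)"
    then show "\<exists>y\<in>carrier (Cl p q). y \<oplus>\<^bsub>Cl p q\<^esub> x = \<zero>\<^bsub>Cl p q\<^esub>"
      by (intro bexI[of _ "\<lambda>S. - x S"]) (auto simp: Cl_simps Cl_carrier_iff)
  qed (auto simp: Cl_simps Cl_carrier_iff)
  show "monoid (Cl p q)"
  proof (rule monoidI)
    fix x assume x: "x \<in> carrier (Cl p q)"
    have 1: "(\<Sum>S\<in>Pow {1..p+q}. cl_sign p S (sym_diff S U) * cl_basis {} S * x (sym_diff S U)) = x U" for U
    proof -
      have "(\<Sum>S\<in>Pow {1..p+q}. cl_sign p S (sym_diff S U) * cl_basis {} S * x (sym_diff S U))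
        = (\<Sum>S\<in>Pow {1..p+q}. if S = {} then x U else 0)"
        by (intro sum.cong) (auto simp: cl_basis_def)
      then show ?thesis by (subst (asm) sum.delta) auto
    qed
    show "\<one>\<^bsub>Cl p q\<^esub> \<otimes>\<^bsub>Cl p q\<^esub> x = x"
      using x by (auto simp: fun_eq_iff Cl_mult Cl_simps Cl_carrier_iff 1[unfolded One_nat_def])
    have 2: "(\<Sum>S\<in>Pow {1..p+q}. cl_sign p S (sym_diff S U) * x S * cl_basis {} (sym_diff S U)) = x U"
      if "U \<subseteq> {1..p+q}" for U
    proof -
      have "(\<Sum>S\<in>Pow {1..p+q}. cl_sign p S (sym_diff S U) * x S * cl_basis {} (sym_diff S U))
        = (\<Sum>S\<in>Pow {1..p+q}. if S = U then x U else 0)"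
        by (intro sum.cong) (auto simp: cl_basis_def)
      then show ?thesis using that by (subst (asm) sum.delta) auto
    qed
    show "x \<otimes>\<^bsub>Cl p q\<^esub> \<one>\<^bsub>Cl p q\<^esub> = x"
      using x by (auto simp: fun_eq_iff Cl_mult Cl_simps Cl_carrier_iff 2[unfolded One_nat_def])
  qed (auto simp: Cl_mult_assoc Cl_carrier_iff Cl_mult Cl_simps(1) cl_basis_def)
qed (auto simp: fun_eq_iff Cl_mult Cl_simps(3) algebra_simps sum.distrib)

lemma Cl_smult_mult:
  "(a \<odot>\<^bsub>Cl p q\<^esub> x) \<otimes>\<^bsub>Cl p q\<^esub> y = a \<odot>\<^bsub>Cl p q\<^esub> (x \<otimes>\<^bsub>Cl p q\<^esub> y)"
  "x \<otimes>\<^bsub>Cl p q\<^esub> (a \<odot>\<^bsub>Cl p q\<^esub> y) = a \<odot>\<^bsub>Cl p q\<^esub> (x \<otimes>\<^bsub>Cl p q\<^esub> y)"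
  by (auto simp: fun_eq_iff Cl_mult Cl_simps(4) sum_distrib_left mult_ac)

lemma Cl_generator_relation:
  assumes "j \<in> {1..p+q}" "k \<in> {1..p+q}"
  shows "(cl_basis {j} \<otimes>\<^bsub>Cl p q\<^esub> cl_basis {k}) \<oplus>\<^bsub>Cl p q\<^esub> (cl_basis {k} \<otimes>\<^bsub>Cl p q\<^esub> cl_basis {j})
    = (if j = k then 2 * cl_eps p j else 0) \<odot>\<^bsub>Cl p q\<^esub> \<one>\<^bsub>Cl p q\<^esub>"
proof -
  have s: "cl_sign p {i} {l} = (if l < i then - 1 else if i = l then cl_eps p i else 1)" for i l
  proof -
    have "{(s, t). s \<in> {i} \<and> t \<in> {l} \<and> t < s} = (if l < i then {(i, l)} else {})" by auto
    then show ?thesis unfolding cl_sign_def by auto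
  qed
  have "{j} \<subseteq> {1..p+q}" "{k} \<subseteq> {1..p+q}" using assms by auto
  note m = cl_basis_mult[OF this] cl_basis_mult[OF this(2,1)]
  show ?thesis
    unfolding m s by (auto simp: Cl_simps fun_eq_iff cl_basis_def)
qed

lemma cl_basis_eq_prod:
  assumes "sorted_wrt (<) js" "set js \<subseteq> {1..p+q}"
  shows "cl_basis (set js) = foldr (\<lambda>j y. cl_basis {j} \<otimes>\<^bsub>Cl p q\<^esub> y) js \<one>\<^bsub>Cl p q\<^esub>"
  using assms
proof (induction js)
  case Nil
  then show ?case by (simp add: Cl_simps)
next
  case (Cons j js)
  then have lt: "\<And>k. k \<in> set js \<Longrightarrow> j < k" and IH:
    "cl_basis (set js) = foldr (\<lambda>j y. cl_basis {j} \<otimes>\<^bsub>Cl p q\<^esub> y) js \<one>\<^bsub>Cl p q\<^esub>"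
    by auto
  have e: "{(s, t). s \<in> {j} \<and> t \<in> set js \<and> t < s} = {}" "{j} \<inter> set js = {}"
    "sym_diff {j} (set js) = insert j (set js)"
    using lt by (auto dest: less_asym)
  have "cl_basis {j} \<otimes>\<^bsub>Cl p q\<^esub> cl_basis (set js) = cl_basis (insert j (set js))"
    using Cons.prems by (subst cl_basis_mult) (simp_all only: e cl_sign_def, auto simp: Cl_simps)
  then show ?case using IH by simp
qed

definition cl_integrable :: "(real \<Rightarrow> nat set \<Rightarrow> real) \<Rightarrow> bool" where
  "cl_integrable g \<longleftrightarrow> (\<forall>S. integrable lebesgue (\<lambda>x. g x S))"

definition cl_integral :: "(real \<Rightarrow> nat set \<Rightarrow> real) \<Rightarrow> nat set \<Rightarrow> real" where
  "cl_integral g = (\<lambda>S. LINT x|lebesgue. g x S)"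

definition cl_differentiable :: "(real \<Rightarrow> nat set \<Rightarrow> real) \<Rightarrow> real \<Rightarrow> bool" where
  "cl_differentiable g t \<longleftrightarrow> (\<forall>S. (\<lambda>u. g u S) field_differentiable (at t))"

definition cl_deriv :: "(real \<Rightarrow> nat set \<Rightarrow> real) \<Rightarrow> real \<Rightarrow> nat set \<Rightarrow> real" where
  "cl_deriv g = (\<lambda>t S. deriv (\<lambda>u. g u S) t)"

definition cl_exp :: "nat \<Rightarrow> nat \<Rightarrow> (nat set \<Rightarrow> real) \<Rightarrow> real \<Rightarrow> nat set \<Rightarrow> real" where
  "cl_exp p q \<mu> \<theta> = (cos \<theta> \<odot>\<^bsub>Cl p q\<^esub> \<one>\<^bsub>Cl p q\<^esub>) \<oplus>\<^bsub>Cl p q\<^esub> (sin \<theta> \<odot>\<^bsub>Cl p q\<^esub> \<mu>)"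

text \<open>
  The coefficients of a Clifford density may be different real densities, so the random variable
  has no single law; it enters the densities and moments below only through \<open>f\<close>.
\<close>

definition cl_pdf :: "nat \<Rightarrow> nat \<Rightarrow> (real \<Rightarrow> nat set \<Rightarrow> real) \<Rightarrow> bool" where
  "cl_pdf p q f \<longleftrightarrow>
    (\<forall>x. f x \<in> carrier (Cl p q)) \<and>
    (\<forall>S. S \<subseteq> {1..p+q} \<longrightarrow>
      (\<forall>x. 0 \<le> f x S) \<and> has_bochner_integral lebesgue (\<lambda>x. f x S) 1)"

definition cl_char :: "nat \<Rightarrow> nat \<Rightarrow> (nat set \<Rightarrow> real) \<Rightarrow> (real \<Rightarrow> nat set \<Rightarrow> real) \<Rightarrow> real \<Rightarrow> nat set \<Rightarrow> real" where
  "cl_char p q \<mu> f t = cl_integral (\<lambda>x. f x \<otimes>\<^bsub>Cl p q\<^esub> cl_exp p q \<mu> (t * x))"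

definition cl_moment :: "nat \<Rightarrow> nat \<Rightarrow> nat \<Rightarrow> (real \<Rightarrow> nat set \<Rightarrow> real) \<Rightarrow> nat set \<Rightarrow> real" where
  "cl_moment p q l f = cl_integral (\<lambda>x. x ^ l \<odot>\<^bsub>Cl p q\<^esub> f x)"

end

theory Submission
  imports Defs
begin

text \<open>
  Since \<open>\<mu>\<^sup>2 = -1\<close>, the coefficients of \<open>g e\<^bsup>\<mu>\<theta>\<^esup> = cos \<theta> g + sin \<theta> g\<mu>\<close> are real trigonometric
  functions of \<open>\<theta>\<close>, so dominated convergence allows differentiation under the integral, each
  derivative replacing \<open>g\<close> by \<open>x g \<mu>\<close>. Starting from \<open>f\<close>, \<open>l\<close> steps give \<open>x\<^sup>l f \<mu>\<^sup>l\<close>; as \<open>\<mu>\<close> commutes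
  with \<open>e\<^bsup>\<mu>\<theta>\<^esup>\<close>, the factor \<open>\<mu>\<^sup>l\<close> can be pulled out to the right. At \<open>t = 0\<close> it is cancelled by
  \<open>(-\<mu>)\<^sup>l\<close>. The lower moments needed on the way exist because \<open>\<bar>x\<bar>\<^sup>k \<le> 1 + \<bar>x\<bar>\<^sup>l\<close> for \<open>k \<le> l\<close>.
\<close>

section \<open>Real analysis: differentiation under the integral and lower moments\<close>

text \<open>By the mean value inequality, the difference quotients along any null sequence are
  bounded by \<open>g\<close>, so dominated convergence gives their limit. The bound on
  \<open>F'\<close> is uniform in \<open>t\<close>, hence covers every point between
  \<open>t\<close> and \<open>t + h i\<close>.\<close>

lemma has_field_derivative_lebesgue_integral:
  fixes F F' :: "real \<Rightarrow> 'a \<Rightarrow> real"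
  assumes int: "\<And>t. integrable M (F t)"
    and deriv: "\<And>t x. ((\<lambda>u. F u x) has_field_derivative F' t x) (at t)"
    and [measurable]: "\<And>t. F' t \<in> borel_measurable M"
    and g: "integrable M g" "\<And>t x. \<bar>F' t x\<bar> \<le> g x"
  shows "((\<lambda>t. LINT x|M. F t x) has_field_derivative (LINT x|M. F' t x)) (at t)"
  unfolding DERIV_def tendsto_at_iff_sequentially comp_def
proof (intro allI impI)
  fix h :: "nat \<Rightarrow> real"
  assume h: "\<forall>i. h i \<in> UNIV - {0}" "h \<longlonglongrightarrow> 0"
  note [measurable] = borel_measurable_integrable[OF int]
  have "(\<lambda>i. LINT x|M. (F (t + h i) x - F t x) / h i) \<longlonglongrightarrow> (LINT x|M. F' t x)"
  proof (rule integral_dominated_convergence[OF _ _ g(1)])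
    show "AE x in M. (\<lambda>i. (F (t + h i) x - F t x) / h i) \<longlonglongrightarrow> F' t x"
      using deriv[of _ t] h unfolding DERIV_def tendsto_at_iff_sequentially comp_def by auto
    have "\<bar>(F (t + h i) x - F t x) / h i\<bar> \<le> g x" for i x
    proof -
      have "norm (F (t + h i) x - F t x) \<le> g x * norm (t + h i - t)"
        by (rule field_differentiable_bound[of UNIV "\<lambda>u. F u x" "\<lambda>u. F' u x"])
           (use deriv g(2) in auto)
      then show ?thesis using h(1) by (simp add: divide_le_eq)
    qed
    then show "AE x in M. norm ((F (t + h i) x - F t x) / h i) \<le> g x" for i by simp
  qed simp_all
  moreover have "(LINT x|M. (F (t + h i) x - F t x) / h i)
      = ((LINT x|M. F (t + h i) x) - (LINT x|M. F t x)) / h i" for i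
    using int by simp
  ultimately show "(\<lambda>i. ((LINT x|M. F (t + h i) x) - (LINT x|M. F t x)) / h i)
      \<longlonglongrightarrow> (LINT x|M. F' t x)"
    by (simp only:)
qed

lemma borel_measurable_lebesgue_continuous:
  "continuous_on UNIV (h :: real \<Rightarrow> real) \<Longrightarrow> h \<in> borel_measurable lebesgue"
  by (intro measurable_completion) (simp add: borel_measurable_continuous_onI)

lemma integrable_power_mult_le:
  fixes a :: "real \<Rightarrow> real"
  assumes "integrable lebesgue a" "integrable lebesgue (\<lambda>x. x ^ l * a x)" "k \<le> l"
  shows "integrable lebesgue (\<lambda>x. x ^ k * a x)"
proof (rule Bochner_Integration.integrable_bound)
  show "integrable lebesgue (\<lambda>x. \<bar>a x\<bar> + \<bar>x ^ l * a x\<bar>)"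
    using assms by (intro Bochner_Integration.integrable_add integrable_abs)
  show "(\<lambda>x. x ^ k * a x) \<in> borel_measurable lebesgue"
    using assms(1)
    by (intro borel_measurable_times borel_measurable_lebesgue_continuous
        borel_measurable_integrable continuous_intros)
  \<comment> \<open>For |x| >= 1 powers increase with the exponent; otherwise the left side is at
    most 1.\<close>
  have "\<bar>x\<bar> ^ k \<le> 1 + \<bar>x\<bar> ^ l" for x :: real
    using power_increasing[OF assms(3), of "\<bar>x\<bar>"] power_le_one[of "\<bar>x\<bar>" k]
    by (cases "1 \<le> \<bar>x\<bar>") (auto intro: add_increasing add_increasing2)
  then have "\<bar>x\<bar> ^ k * \<bar>a x\<bar> \<le> (1 + \<bar>x\<bar> ^ l) * \<bar>a x\<bar>" for x
    by (intro mult_right_mono) auto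
  then show "AE x in lebesgue. norm (x ^ k * a x) \<le> norm (\<bar>a x\<bar> + \<bar>x ^ l * a x\<bar>)"
    by (simp add: abs_mult power_abs algebra_simps)
qed

section \<open>Algebra of the exponential and of powers of \<open>\<mu>\<close>\<close>

text \<open>The additive inverse of a ring is defined by a description, so its coefficients come
  from uniqueness. This turns \<mu>^2 = -1 into a sign change of coefficients.\<close>

lemma Cl_a_inv:
  assumes "x \<in> carrier (Cl p q)"
  shows "\<ominus>\<^bsub>Cl p q\<^esub> x = (\<lambda>S. - x S)"
proof -
  interpret ring "Cl p q" by (rule ring_Cl)
  show ?thesis
    using assms by (intro minus_equality) (auto simp: Cl_simps Cl_carrier_iff)
qed

lemma Cl_smult_closed:
  "x \<in> carrier (Cl p q) \<Longrightarrow> a \<odot>\<^bsub>Cl p q\<^esub> x \<in> carrier (Cl p q)"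
  by (simp add: Cl_carrier_iff Cl_simps)

lemma cl_exp_carrier: "\<mu> \<in> carrier (Cl p q) \<Longrightarrow> cl_exp p q \<mu> \<theta> \<in> carrier (Cl p q)"
  by (auto simp: cl_exp_def Cl_carrier_iff Cl_simps cl_basis_def)

lemma cl_exp_0: "cl_exp p q \<mu> 0 = \<one>\<^bsub>Cl p q\<^esub>"
  by (simp add: cl_exp_def Cl_simps)

lemma mult_cl_exp:
  assumes "x \<in> carrier (Cl p q)" "\<mu> \<in> carrier (Cl p q)"
  shows "x \<otimes>\<^bsub>Cl p q\<^esub> cl_exp p q \<mu> \<theta> =
    (cos \<theta> \<odot>\<^bsub>Cl p q\<^esub> x) \<oplus>\<^bsub>Cl p q\<^esub> (sin \<theta> \<odot>\<^bsub>Cl p q\<^esub> (x \<otimes>\<^bsub>Cl p q\<^esub> \<mu>))"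
proof -
  interpret ring "Cl p q" by (rule ring_Cl)
  show ?thesis
    using assms by (simp add: cl_exp_def r_distr Cl_smult_closed Cl_smult_mult)
qed

text \<open>The exponential is a real combination of 1 and \<open>\<mu>\<close>, and real scalars
  are central.\<close>

lemma cl_exp_mult_commute:
  assumes "\<mu> \<in> carrier (Cl p q)"
  shows "cl_exp p q \<mu> \<theta> \<otimes>\<^bsub>Cl p q\<^esub> \<mu> = \<mu> \<otimes>\<^bsub>Cl p q\<^esub> cl_exp p q \<mu> \<theta>"
proof -
  interpret ring "Cl p q" by (rule ring_Cl)
  show ?thesis
    using assms by (simp add: cl_exp_def l_distr r_distr Cl_smult_closed Cl_smult_mult)
qed

lemma cl_exp_mult_pow_commute:
  assumes \<mu>: "\<mu> \<in> carrier (Cl p q)"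
  shows "cl_exp p q \<mu> \<theta> \<otimes>\<^bsub>Cl p q\<^esub> (\<mu> [^]\<^bsub>Cl p q\<^esub> (n::nat))
    = (\<mu> [^]\<^bsub>Cl p q\<^esub> n) \<otimes>\<^bsub>Cl p q\<^esub> cl_exp p q \<mu> \<theta>"
proof -
  interpret ring "Cl p q" by (rule ring_Cl)
  show ?thesis
    using group_commutes_pow[OF cl_exp_mult_commute[OF \<mu>, symmetric]] \<mu> cl_exp_carrier[OF \<mu>]
    by simp
qed

text \<open>Since \<mu>(-\<mu>) = -\<mu>^2 = 1 and the two factors commute, the product of the
  powers is a power of 1.\<close>

lemma Cl_pow_mult_minus_pow:
  assumes \<mu>: "\<mu> \<in> carrier (Cl p q)"
    and sq: "\<mu> \<otimes>\<^bsub>Cl p q\<^esub> \<mu> = \<ominus>\<^bsub>Cl p q\<^esub> \<one>\<^bsub>Cl p q\<^esub>"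
  shows "(\<mu> [^]\<^bsub>Cl p q\<^esub> (n::nat)) \<otimes>\<^bsub>Cl p q\<^esub> ((\<ominus>\<^bsub>Cl p q\<^esub> \<mu>) [^]\<^bsub>Cl p q\<^esub> n) = \<one>\<^bsub>Cl p q\<^esub>"
proof -
  interpret ring "Cl p q" by (rule ring_Cl)
  have "\<mu> \<otimes>\<^bsub>Cl p q\<^esub> (\<ominus>\<^bsub>Cl p q\<^esub> \<mu>) = \<one>\<^bsub>Cl p q\<^esub>" "(\<ominus>\<^bsub>Cl p q\<^esub> \<mu>) \<otimes>\<^bsub>Cl p q\<^esub> \<mu> = \<one>\<^bsub>Cl p q\<^esub>"
    using \<mu> sq by (simp_all add: r_minus l_minus)
  then show ?thesis
    using \<mu> by (subst pow_mult_distrib[symmetric]) auto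
qed

section \<open>Coefficientwise integrals of Clifford-valued functions\<close>

text \<open>Each coefficient of a product with a constant is a finite real linear combination of
  coefficients of \<open>g\<close>. The same expansion lets constants leave the integral on the
  right in the next lemma.\<close>

lemma cl_integrable_mult_right:
  assumes "cl_integrable g"
  shows "cl_integrable (\<lambda>x. g x \<otimes>\<^bsub>Cl p q\<^esub> c)"
  unfolding cl_integrable_def
proof
  fix U
  have "integrable lebesgue
    (\<lambda>x. \<Sum>S\<in>Pow {1..p+q}. cl_sign p S (sym_diff S U) * g x S * c (sym_diff S U))"
    using assms
    by (intro Bochner_Integration.integrable_sum integrable_mult_left integrable_mult_right)
       (simp add: cl_integrable_def)
  then show "integrable lebesgue (\<lambda>x. (g x \<otimes>\<^bsub>Cl p q\<^esub> c) U)"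
    by (cases "U \<subseteq> {1..p+q}") (simp_all add: Cl_mult)
qed

lemma cl_integral_mult_right:
  assumes "cl_integrable g"
  shows "cl_integral (\<lambda>x. g x \<otimes>\<^bsub>Cl p q\<^esub> c) = cl_integral g \<otimes>\<^bsub>Cl p q\<^esub> c"
proof
  fix U
  have int: "integrable lebesgue (\<lambda>x. g x S)" for S
    using assms by (simp add: cl_integrable_def)
  have "(LINT x|lebesgue. (\<Sum>S\<in>Pow {1..p+q}. cl_sign p S (sym_diff S U) * g x S * c (sym_diff S U)))
    = (\<Sum>S\<in>Pow {1..p+q}. (LINT x|lebesgue. cl_sign p S (sym_diff S U) * g x S * c (sym_diff S U)))"
    using int by (intro Bochner_Integration.integral_sum integrable_mult_left integrable_mult_right)
  then show "cl_integral (\<lambda>x. g x \<otimes>\<^bsub>Cl p q\<^esub> c) U = (cl_integral g \<otimes>\<^bsub>Cl p q\<^esub> c) U"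
    by (cases "U \<subseteq> {1..p+q}") (simp_all add: cl_integral_def Cl_mult int)
qed

lemma cl_integrable_mult_cl_exp:
  assumes \<mu>: "\<mu> \<in> carrier (Cl p q)" and g: "\<And>x. g x \<in> carrier (Cl p q)" "cl_integrable g"
  shows "cl_integrable (\<lambda>x. g x \<otimes>\<^bsub>Cl p q\<^esub> cl_exp p q \<mu> (t * x))"
  unfolding cl_integrable_def
proof
  fix U
  \<comment> \<open>To be used with h(x) = cos(tx) and h(x) = sin(tx).\<close>
  have bounded: "integrable lebesgue (\<lambda>x. h x * a x)"
    if a: "integrable lebesgue a" and h: "continuous_on UNIV h" "\<And>x. \<bar>h x\<bar> \<le> 1"
    for a h :: "real \<Rightarrow> real"
  proof (rule Bochner_Integration.integrable_bound[OF a])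
    show "(\<lambda>x. h x * a x) \<in> borel_measurable lebesgue"
      using a h(1) borel_measurable_lebesgue_continuous by (intro borel_measurable_times) auto
    show "AE x in lebesgue. norm (h x * a x) \<le> norm (a x)"
      using h(2) by (auto simp: abs_mult mult_left_le_one_le)
  qed
  have "integrable lebesgue (\<lambda>x. g x U)" "integrable lebesgue (\<lambda>x. (g x \<otimes>\<^bsub>Cl p q\<^esub> \<mu>) U)"
    using g(2) cl_integrable_mult_right[OF g(2)] unfolding cl_integrable_def by auto
  then show "integrable lebesgue (\<lambda>x. (g x \<otimes>\<^bsub>Cl p q\<^esub> cl_exp p q \<mu> (t * x)) U)"
    using \<mu> g(1)
    by (simp add: mult_cl_exp Cl_simps)
       (intro Bochner_Integration.integrable_add bounded continuous_intros; simp)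
qed

lemma has_field_derivative_cl_integral_cl_exp:
  assumes \<mu>: "\<mu> \<in> carrier (Cl p q)"
    and sq: "\<mu> \<otimes>\<^bsub>Cl p q\<^esub> \<mu> = \<ominus>\<^bsub>Cl p q\<^esub> \<one>\<^bsub>Cl p q\<^esub>"
    and g: "\<And>x. g x \<in> carrier (Cl p q)" "cl_integrable g" "cl_integrable (\<lambda>x. x \<odot>\<^bsub>Cl p q\<^esub> g x)"
  shows "((\<lambda>t. cl_integral (\<lambda>x. g x \<otimes>\<^bsub>Cl p q\<^esub> cl_exp p q \<mu> (t * x)) U) has_field_derivative
    cl_integral (\<lambda>x. (x \<odot>\<^bsub>Cl p q\<^esub> (g x \<otimes>\<^bsub>Cl p q\<^esub> \<mu>)) \<otimes>\<^bsub>Cl p q\<^esub> cl_exp p q \<mu> (t * x)) U) (at t)"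
proof -
  interpret ring "Cl p q" by (rule ring_Cl)
  let ?G = "\<lambda>x. g x \<otimes>\<^bsub>Cl p q\<^esub> \<mu>"
  have "?G x \<otimes>\<^bsub>Cl p q\<^esub> \<mu> = (\<lambda>S. - g x S)" for x
    using \<mu> g(1) by (simp add: m_assoc sq r_minus Cl_a_inv[OF g(1)])
  \<comment> \<open>As g \<mu> \<mu> = -g, expanding the product yields exactly the derivative in t
    of cos(tx) g + sin(tx) g \<mu>; the factor x is the one from the chain rule.\<close>
  then have exp': "((x \<odot>\<^bsub>Cl p q\<^esub> ?G x) \<otimes>\<^bsub>Cl p q\<^esub> cl_exp p q \<mu> \<theta>) U
      = x * (cos \<theta> * ?G x U - sin \<theta> * g x U)" for x \<theta>
    using \<mu> g(1) by (simp add: Cl_smult_mult mult_cl_exp) (simp add: Cl_simps)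
  have int: "cl_integrable (\<lambda>x. x \<odot>\<^bsub>Cl p q\<^esub> ?G x)"
    using cl_integrable_mult_right[OF g(3), of p q \<mu>] by (simp add: Cl_smult_mult)
  show ?thesis
    unfolding cl_integral_def
  proof (rule has_field_derivative_lebesgue_integral)
    show "integrable lebesgue (\<lambda>x. (g x \<otimes>\<^bsub>Cl p q\<^esub> cl_exp p q \<mu> (t * x)) U)" for t
      using cl_integrable_mult_cl_exp[OF \<mu> g(1,2)] by (simp add: cl_integrable_def)
    show "((\<lambda>u. (g x \<otimes>\<^bsub>Cl p q\<^esub> cl_exp p q \<mu> (u * x)) U) has_field_derivative
        ((x \<odot>\<^bsub>Cl p q\<^esub> ?G x) \<otimes>\<^bsub>Cl p q\<^esub> cl_exp p q \<mu> (t * x)) U) (at t)" for t x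
      unfolding exp' mult_cl_exp[OF g(1) \<mu>] unfolding Cl_simps
      by (auto intro!: derivative_eq_intros simp: algebra_simps)
    show "(\<lambda>x. ((x \<odot>\<^bsub>Cl p q\<^esub> ?G x) \<otimes>\<^bsub>Cl p q\<^esub> cl_exp p q \<mu> (t * x)) U) \<in> borel_measurable lebesgue"
      for t
      using cl_integrable_mult_cl_exp[OF \<mu> _ int] \<mu> g(1)
      by (intro borel_measurable_integrable) (simp add: Cl_smult_closed cl_integrable_def)
    \<comment> \<open>The dominating function comes from |cos|, |sin| <= 1 and is therefore
      independent of t.\<close>
    show "integrable lebesgue (\<lambda>x. \<bar>(x \<odot>\<^bsub>Cl p q\<^esub> ?G x) U\<bar> + \<bar>(x \<odot>\<^bsub>Cl p q\<^esub> g x) U\<bar>)"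
      using int g(3) unfolding cl_integrable_def
      by (intro Bochner_Integration.integrable_add integrable_abs) auto
    fix t x
    have "\<bar>cos (t * x) * ?G x U - sin (t * x) * g x U\<bar> \<le> \<bar>?G x U\<bar> + \<bar>g x U\<bar>"
      by (rule order.trans[OF abs_triangle_ineq4])
         (auto simp: abs_mult intro!: add_mono mult_left_le_one_le)
    then have "\<bar>x\<bar> * \<bar>cos (t * x) * ?G x U - sin (t * x) * g x U\<bar> \<le> \<bar>x\<bar> * (\<bar>?G x U\<bar> + \<bar>g x U\<bar>)"
      by (rule mult_left_mono) simp
    then show "\<bar>((x \<odot>\<^bsub>Cl p q\<^esub> ?G x) \<otimes>\<^bsub>Cl p q\<^esub> cl_exp p q \<mu> (t * x)) U\<bar>
        \<le> \<bar>(x \<odot>\<^bsub>Cl p q\<^esub> ?G x) U\<bar> + \<bar>(x \<odot>\<^bsub>Cl p q\<^esub> g x) U\<bar>"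
      unfolding exp' by (simp add: Cl_simps abs_mult distrib_left)
  qed
qed

section \<open>Iterated derivatives of the characteristic function and the moment formula\<close>

theorem theorem4p5:
  fixes p q l :: nat
    and \<mu> :: "nat set \<Rightarrow> real"
    and f :: "real \<Rightarrow> nat set \<Rightarrow> real"
  assumes "\<mu> \<in> carrier (Cl p q)"
    and "\<mu> [^]\<^bsub>Cl p q\<^esub> (2::nat) = \<ominus>\<^bsub>Cl p q\<^esub> \<one>\<^bsub>Cl p q\<^esub>"
    and "l \<ge> 1"
    and "cl_pdf p q f"
    and "cl_integrable (\<lambda>x. x ^ l \<odot>\<^bsub>Cl p q\<^esub> f x)"
  shows "(\<forall>k<l. \<forall>t. cl_differentiable ((cl_deriv ^^ k) (cl_char p q \<mu> f)) t) \<and>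
    (\<forall>t. (cl_deriv ^^ l) (cl_char p q \<mu> f) t =
       cl_integral (\<lambda>x. x ^ l \<odot>\<^bsub>Cl p q\<^esub> (f x \<otimes>\<^bsub>Cl p q\<^esub> cl_exp p q \<mu> (t * x)))
         \<otimes>\<^bsub>Cl p q\<^esub> (\<mu> [^]\<^bsub>Cl p q\<^esub> l)) \<and>
    cl_moment p q l f =
      (cl_deriv ^^ l) (cl_char p q \<mu> f) 0 \<otimes>\<^bsub>Cl p q\<^esub> ((\<ominus>\<^bsub>Cl p q\<^esub> \<mu>) [^]\<^bsub>Cl p q\<^esub> l)"
proof -
  interpret ring "Cl p q" by (rule ring_Cl)
  note \<mu> = assms(1)
  have sq: "\<mu> \<otimes>\<^bsub>Cl p q\<^esub> \<mu> = \<ominus>\<^bsub>Cl p q\<^esub> \<one>\<^bsub>Cl p q\<^esub>"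
    using assms(1,2) by (simp add: numeral_2_eq_2)
  have f: "f x \<in> carrier (Cl p q)" for x
    using assms(4) by (simp add: cl_pdf_def)
  \<comment> \<open>\<open>cl_integrable\<close> ranges over all index sets, while the density
    condition covers only subsets of \<open>{1..p+q}\<close>; the other coefficients vanish.\<close>
  have f_int: "integrable lebesgue (\<lambda>x. f x S)" for S
  proof (cases "S \<subseteq> {1..p+q}")
    case True
    then show ?thesis using assms(4) by (auto simp: cl_pdf_def has_bochner_integral_iff)
  next
    case False
    then have "(\<lambda>x. f x S) = (\<lambda>x. 0)" using f by (simp add: Cl_carrier_iff)
    then show ?thesis by simp
  qed
  \<comment> \<open>In the k-th derivative, \<mu>^k is kept to the left of the exponential, so that
    the one-step derivative lemma applies again with \<open>g k\<close> as its integrand.\<close>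
  define g where "g k = (\<lambda>x. x ^ k \<odot>\<^bsub>Cl p q\<^esub> (f x \<otimes>\<^bsub>Cl p q\<^esub> (\<mu> [^]\<^bsub>Cl p q\<^esub> k)))" for k :: nat
  have g: "g k x \<in> carrier (Cl p q)" for k x
    using f \<mu> by (simp add: g_def Cl_smult_closed)
  have pow_int: "cl_integrable (\<lambda>x. x ^ k \<odot>\<^bsub>Cl p q\<^esub> f x)" if "k \<le> l" for k
    using assms(5) that f_int integrable_power_mult_le
    unfolding cl_integrable_def Cl_simps by blast
  have g_int: "cl_integrable (g k)" if "k \<le> l" for k
    using cl_integrable_mult_right[OF pow_int[OF that], of p q "\<mu> [^]\<^bsub>Cl p q\<^esub> k"]
    by (simp add: g_def Cl_smult_mult)
  \<comment> \<open>The extra factor x calls for the moment of order k + 1, whence the strict bound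
    on k.\<close>
  have xg_int: "cl_integrable (\<lambda>x. x \<odot>\<^bsub>Cl p q\<^esub> g k x)" if "k < l" for k
    using cl_integrable_mult_right[OF pow_int[of "Suc k"], of p q "\<mu> [^]\<^bsub>Cl p q\<^esub> k"] that
    by (simp add: g_def Cl_smult_mult) (simp add: Cl_simps mult_ac)
  have g_Suc: "x \<odot>\<^bsub>Cl p q\<^esub> (g k x \<otimes>\<^bsub>Cl p q\<^esub> \<mu>) = g (Suc k) x" for k x
    using f \<mu> by (simp add: g_def Cl_smult_mult m_assoc) (simp add: Cl_simps mult_ac)
  have step: "((\<lambda>t. cl_integral (\<lambda>x. g k x \<otimes>\<^bsub>Cl p q\<^esub> cl_exp p q \<mu> (t * x)) U) has_field_derivative
      cl_integral (\<lambda>x. g (Suc k) x \<otimes>\<^bsub>Cl p q\<^esub> cl_exp p q \<mu> (t * x)) U) (at t)"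
    if "k < l" for k t U
    using has_field_derivative_cl_integral_cl_exp[where g = "g k", OF \<mu> sq g] g_int[of k] xg_int[of k] that
    by (simp add: g_Suc)
  have deriv: "(cl_deriv ^^ k) (cl_char p q \<mu> f)
      = (\<lambda>t. cl_integral (\<lambda>x. g k x \<otimes>\<^bsub>Cl p q\<^esub> cl_exp p q \<mu> (t * x)))" if "k \<le> l" for k
    using that
  proof (induction k)
    case 0
    then show ?case using f by (simp add: cl_char_def fun_eq_iff g_def) (simp add: Cl_simps)
  next
    case (Suc k)
    then show ?case using DERIV_imp_deriv[OF step[of k]] by (simp add: cl_deriv_def)
  qed
  \<comment> \<open>\<open>deriv\<close> is total, so the formula for the iterated derivative does
    not by itself give differentiability; that is read off from \<open>step\<close>.\<close>
  have diff: "cl_differentiable ((cl_deriv ^^ k) (cl_char p q \<mu> f)) t" if "k < l" for k t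
    using step[OF that] deriv[of k] that
    unfolding cl_differentiable_def field_differentiable_def by auto
  have main: "(cl_deriv ^^ l) (cl_char p q \<mu> f) t =
       cl_integral (\<lambda>x. x ^ l \<odot>\<^bsub>Cl p q\<^esub> (f x \<otimes>\<^bsub>Cl p q\<^esub> cl_exp p q \<mu> (t * x)))
         \<otimes>\<^bsub>Cl p q\<^esub> (\<mu> [^]\<^bsub>Cl p q\<^esub> l)" for t
  proof -
    \<comment> \<open>Only here does \<mu>^l move past the exponential, to become a constant right
      factor of the integrand.\<close>
    have "g l x \<otimes>\<^bsub>Cl p q\<^esub> cl_exp p q \<mu> (t * x) =
        (x ^ l \<odot>\<^bsub>Cl p q\<^esub> (f x \<otimes>\<^bsub>Cl p q\<^esub> cl_exp p q \<mu> (t * x))) \<otimes>\<^bsub>Cl p q\<^esub> (\<mu> [^]\<^bsub>Cl p q\<^esub> l)" for x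
      using f \<mu> by (simp add: g_def Cl_smult_mult Cl_mult_assoc cl_exp_mult_pow_commute)
    moreover have "cl_integrable (\<lambda>x. x ^ l \<odot>\<^bsub>Cl p q\<^esub> (f x \<otimes>\<^bsub>Cl p q\<^esub> cl_exp p q \<mu> (t * x)))"
      using cl_integrable_mult_cl_exp[OF \<mu> _ assms(5)] f by (simp add: Cl_smult_closed Cl_smult_mult)
    ultimately show ?thesis by (simp add: deriv cl_integral_mult_right)
  qed
  \<comment> \<open>At t = 0 the exponential is 1 and the powers of \<mu> and -\<mu> cancel, leaving
    the moment times 1; membership in the carrier makes the unit law applicable.\<close>
  have "cl_moment p q l f \<in> carrier (Cl p q)"
    using f by (simp add: cl_moment_def cl_integral_def Cl_carrier_iff Cl_simps)
  then have "cl_moment p q l f =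
      (cl_deriv ^^ l) (cl_char p q \<mu> f) 0 \<otimes>\<^bsub>Cl p q\<^esub> ((\<ominus>\<^bsub>Cl p q\<^esub> \<mu>) [^]\<^bsub>Cl p q\<^esub> l)"
    using f \<mu> Cl_pow_mult_minus_pow[OF \<mu> sq]
    by (simp add: main cl_exp_0 Cl_mult_assoc flip: cl_moment_def)
  with diff main show ?thesis by blast
qed

end
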